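(* For every integer $n\geq 3$, $$\left|\sum_{k\leq n}\Omega(k)-(n-1)\log\log(n-1)\right|<23(n-1),$$ where the sum runs over the positive integers $k\leq n$.
   Context: $\Omega(k)$ denotes the total number of prime factors of the positive integer $k$, counted with multiplicity (so $\Omega(1)=0$). $\log$ denotes the natural logarithm. *)

theory Defs
  imports Complex_Main "HOL-Computational_Algebra.Primes"
begin

definition prime_Omega :: "nat \<Rightarrow> nat" where
  "prime_Omega k = size (prime_factorization k)"

end

theory Submission
  imports Defs
begin

text \<open>
  Counting the prime factors of 1, ..., m prime by prime, the sum of \<Omega>(k) over k \<le> m is
  the sum over primes p \<le> m of the exponent of p in m!, which lies between m/p - 1 and m/(p - 1);
  hence it equals m times the sum of 1/p, up to O(m). Weighting the same count with log p gives log m!,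
  and with Chebyshev's bound on the product of the primes up to m this yields Mertens' first theorem;
  Abel summation turns it into an explicit form of his second theorem. Finally m = n - 1 is
  reached from n at the cost of \<Omega>(n) \<le> n - 1.
\<close>

section \<open>Exponents of primes in factorials\<close>

lemma finite_primes_le [simp]: "finite {p::nat. prime p \<and> p \<le> n}"
  by (rule finite_subset[of _ "{..n}"]) auto

text \<open>One step of Legendre's formula for the exponent of \<open>p\<close> in
  \<open>n!\<close>: only the multiples \<open>p * j\<close> contribute, and each contributes one
  more than \<open>j\<close> does.\<close>

lemma sum_multiplicity_rec:
  fixes p n :: nat
  assumes "prime p"
  shows "(\<Sum>k=1..n. multiplicity p k) = n div p + (\<Sum>k=1..n div p. multiplicity p k)"
proof -
  have p: "p > 1" using assms prime_gt_1_nat by blast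
  have "(\<Sum>k=1..n. multiplicity p k) = (\<Sum>k\<in>(\<lambda>j. p * j) ` {1..n div p}. multiplicity p k)"
  proof (rule sum.mono_neutral_right)
    show "(\<lambda>j. p * j) ` {1..n div p} \<subseteq> {1..n}"
      using p by (auto simp: less_eq_div_iff_mult_less_eq mult.commute)
    show "\<forall>i\<in>{1..n} - (\<lambda>j. p * j) ` {1..n div p}. multiplicity p i = 0"
    proof
      fix i assume i: "i \<in> {1..n} - (\<lambda>j. p * j) ` {1..n div p}"
      have "\<not> p dvd i"
      proof
        assume "p dvd i"
        then obtain j where j: "i = p * j" by blast
        with i p have "j \<in> {1..n div p}"
          by (auto simp: less_eq_div_iff_mult_less_eq mult.commute Suc_le_eq)
        with i j show False by blast
      qed
      thus "multiplicity p i = 0" by (rule not_dvd_imp_multiplicity_0)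
    qed
  qed auto
  also have "\<dots> = (\<Sum>j=1..n div p. multiplicity p (p * j))"
    using p by (subst sum.reindex) (auto simp: inj_on_def)
  also have "\<dots> = (\<Sum>j=1..n div p. 1 + multiplicity p j)"
    using p by (intro sum.cong) (auto simp: multiplicity_times_same)
  also have "\<dots> = n div p + (\<Sum>j=1..n div p. multiplicity p j)"
    by (subst sum.distrib) simp
  finally show ?thesis .
qed

text \<open>This replaces the geometric series n/p + n/p^2 + ... = n/(p - 1). With
  \<open>q = n div p\<close>, the recursion and the induction hypothesis at \<open>q\<close> give at
  most \<open>(p - 1) * q + q = p * q\<close>.\<close>

lemma sum_multiplicity_le:
  fixes p n :: nat
  assumes "prime p"
  shows "(p - 1) * (\<Sum>k=1..n. multiplicity p k) \<le> n"
proof (induction n rule: less_induct)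
  case (less n)
  have p: "p > 1" using assms prime_gt_1_nat by blast
  show ?case
  proof (cases "n = 0")
    case False
    let ?q = "n div p"
    have "(p - 1) * (\<Sum>k=1..n. multiplicity p k) =
        (p - 1) * ?q + (p - 1) * (\<Sum>k=1..?q. multiplicity p k)"
      by (subst sum_multiplicity_rec[OF assms]) (simp add: algebra_simps)
    also have "\<dots> \<le> (p - 1) * ?q + ?q"
      using less[of ?q] p False by simp
    also have "\<dots> = p * ?q"
      using p by (cases p) auto
    also have "\<dots> \<le> n" by simp
    finally show ?thesis .
  qed auto
qed

text \<open>Writing 1/(p - 1) as 1/p + 1/(p(p - 1)) separates the main term from a correction whose
  sum over all primes converges, even when weighted with \<open>ln p\<close>.\<close>

lemma sum_multiplicity_upper:
  fixes p n :: nat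
  assumes "prime p"
  shows "real (\<Sum>k=1..n. multiplicity p k) \<le> real n * (1 / real p + 1 / (real p * (real p - 1)))"
proof -
  have p: "p > 1" using assms prime_gt_1_nat by blast
  have "real ((p - 1) * (\<Sum>k=1..n. multiplicity p k)) \<le> real n"
    using sum_multiplicity_le[OF assms, of n] of_nat_le_iff by blast
  hence "(real p - 1) * real (\<Sum>k=1..n. multiplicity p k) \<le> real n"
    using p by (simp add: of_nat_diff)
  hence "real (\<Sum>k=1..n. multiplicity p k) \<le> real n / (real p - 1)"
    using p by (simp add: field_simps)
  also have "\<dots> = real n * (1 / real p + 1 / (real p * (real p - 1)))"
    using p by (simp add: divide_simps)
  finally show ?thesis .
qed

text \<open>The first term of Legendre's formula, \<open>n div p\<close>, already suffices.\<close>

lemma sum_multiplicity_lower: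
  fixes p n :: nat
  assumes "prime p"
  shows "real n / real p - 1 \<le> real (\<Sum>k=1..n. multiplicity p k)"
proof -
  have p: "p > 0" using assms prime_gt_0_nat by blast
  have "n < p * (n div p + 1)"
    using p dividend_less_times_div[of p n] by simp
  hence "real n < real (p * (n div p + 1))" by (simp only: of_nat_less_iff)
  hence "real n / real p - 1 \<le> real (n div p)"
    using p by (simp add: field_simps)
  also have "\<dots> \<le> real (\<Sum>k=1..n. multiplicity p k)"
    by (subst sum_multiplicity_rec[OF assms]) (simp only: of_nat_le_iff le_add1)
  finally show ?thesis .
qed

text \<open>An index set that does not depend on \<open>k\<close> allows the sums over
  \<open>k\<close> and \<open>p\<close> to be swapped. The weight \<open>f\<close> will be 1 for
  \<open>prime_Omega k\<close> and \<open>ln p\<close> for \<open>ln k\<close>.\<close>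

lemma sum_prime_factors_extend:
  fixes f :: "nat \<Rightarrow> real"
  assumes "k \<in> {1..n}"
  shows "(\<Sum>p\<in>prime_factors k. f p * real (multiplicity p k)) =
         (\<Sum>p | prime p \<and> p \<le> n. f p * real (multiplicity p k))"
proof (rule sum.mono_neutral_left)
  show "prime_factors k \<subseteq> {p. prime p \<and> p \<le> n}"
  proof
    fix p assume "p \<in> prime_factors k"
    hence "prime p" "p dvd k" by (auto dest: in_prime_factors_imp_prime in_prime_factors_imp_dvd)
    with assms dvd_imp_le[of p k] show "p \<in> {p. prime p \<and> p \<le> n}" by auto
  qed
  show "\<forall>p\<in>{p. prime p \<and> p \<le> n} - prime_factors k. f p * real (multiplicity p k) = 0"
    using assms by (auto simp: prime_factors_multiplicity)
qed auto

lemma sum_prime_Omega: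
  "(\<Sum>k=1..n. real (prime_Omega k)) =
     (\<Sum>p | prime p \<and> p \<le> n. real (\<Sum>k=1..n. multiplicity p k))"
proof -
  have *: "real (prime_Omega k) = (\<Sum>p | prime p \<and> p \<le> n. real (multiplicity p k))"
    if k: "k \<in> {1..n}" for k
  proof -
    have "prime_Omega k = (\<Sum>p\<in>prime_factors k. multiplicity p k)"
      unfolding prime_Omega_def size_multiset_overloaded_eq
      by (intro sum.cong refl count_prime_factorization_prime in_prime_factors_imp_prime)
    thus ?thesis
      using sum_prime_factors_extend[OF k, of "\<lambda>_. 1"] by (simp only: of_nat_sum mult_1)
  qed
  have "(\<Sum>k=1..n. real (prime_Omega k)) =
     (\<Sum>k=1..n. \<Sum>p | prime p \<and> p \<le> n. real (multiplicity p k))"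
    by (intro sum.cong refl *)
  also have "\<dots> = (\<Sum>p | prime p \<and> p \<le> n. \<Sum>k=1..n. real (multiplicity p k))"
    by (rule sum.swap)
  finally show ?thesis by simp
qed

lemma ln_fact_prime_sum:
  "ln (fact n) = (\<Sum>p | prime p \<and> p \<le> n. ln (real p) * real (\<Sum>k=1..n. multiplicity p k))"
proof -
  have *: "ln (real k) = (\<Sum>p | prime p \<and> p \<le> n. ln (real p) * real (multiplicity p k))"
    if k: "k \<in> {1..n}" for k
  proof -
    have "real k = real (\<Prod>p\<in>prime_factors k. p ^ multiplicity p k)"
      using k by (subst prime_factorization_nat[symmetric]) auto
    hence "ln (real k) = ln (\<Prod>p\<in>prime_factors k. real p ^ multiplicity p k)"
      by simp
    also have "\<dots> = (\<Sum>p\<in>prime_factors k. ln (real p ^ multiplicity p k))"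
      by (subst ln_prod) (auto dest: in_prime_factors_imp_prime prime_gt_0_nat)
    also have "\<dots> = (\<Sum>p\<in>prime_factors k. ln (real p) * real (multiplicity p k))"
      by (intro sum.cong refl, subst ln_realpow)
        (auto dest: in_prime_factors_imp_prime prime_gt_0_nat)
    also have "\<dots> = (\<Sum>p | prime p \<and> p \<le> n. ln (real p) * real (multiplicity p k))"
      by (rule sum_prime_factors_extend[OF k])
    finally show ?thesis .
  qed
  have "ln (fact n :: real) = (\<Sum>k=1..n. ln (real k))"
    unfolding fact_prod of_nat_prod by (subst ln_prod) auto
  also have "\<dots> = (\<Sum>k=1..n. \<Sum>p | prime p \<and> p \<le> n. ln (real p) * real (multiplicity p k))"
    by (intro sum.cong refl *)
  also have "\<dots> = (\<Sum>p | prime p \<and> p \<le> n. \<Sum>k=1..n. ln (real p) * real (multiplicity p k))"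
    by (rule sum.swap)
  finally show ?thesis by (simp add: sum_distrib_left)
qed

section \<open>Weak Stirling bounds\<close>

lemma ln_fact_lower: "n > 0 \<Longrightarrow> real n * ln (real n) - real n \<le> ln (fact n)"
proof (induction n rule: nat_induct_non_zero)
  case (Suc n)
  have "ln (real (Suc n) / real n) \<le> real (Suc n) / real n - 1"
    using Suc.hyps by (intro ln_le_minus_one) auto
  hence "ln (real (Suc n)) - ln (real n) \<le> 1 / real n"
    using Suc.hyps by (subst (asm) ln_div) (auto simp: add_divide_distrib)
  hence "real n * (ln (real (Suc n)) - ln (real n)) \<le> real n * (1 / real n)"
    by (rule mult_left_mono) simp
  hence "real n * (ln (real (Suc n)) - ln (real n)) \<le> 1"
    using Suc.hyps by simp
  moreover have "ln (fact (Suc n)) = ln (real (Suc n)) + ln (fact n)"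
    by (simp only: fact_Suc of_nat_mult, subst ln_mult) auto
  moreover have "real (Suc n) * ln (real (Suc n)) = real n * ln (real (Suc n)) + ln (real (Suc n))"
    by (simp add: distrib_right)
  ultimately show ?case using Suc.IH
    unfolding right_diff_distrib by linarith
qed auto

lemma ln_fact_upper: "ln (fact n) \<le> real n * ln (real n)"
proof (cases "n = 0")
  case False
  have "ln (fact n :: real) \<le> ln (real n ^ n)"
    using False fact_le_power[of n] by (subst ln_le_cancel_iff) (auto)
  thus ?thesis using False by (simp add: ln_realpow)
qed auto

section \<open>Chebyshev's bound on the product of primes\<close>

lemma prod_primes_dvd:
  fixes x :: nat
  assumes "finite A" "\<And>p. p \<in> A \<Longrightarrow> prime p" "\<And>p. p \<in> A \<Longrightarrow> p dvd x"
  shows "\<Prod>A dvd x"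
  using assms
proof (induction A rule: finite_induct)
  case (insert p A)
  have "coprime p (\<Prod>A)"
    using insert.hyps insert.prems by (intro prod_coprime_right) (auto intro!: primes_coprime)
  thus ?case using insert by (simp add: divides_mult)
qed auto

text \<open>Erdos's argument. An even \<open>n > 2\<close> is not prime, so \<open>n - 1\<close>
  gives the same product. For \<open>n = 2 * m + 1\<close>, the primes up to \<open>m + 1\<close>
  contribute at most \<open>4 ^ (m + 1)\<close> by induction, and the larger ones at most a central
  binomial coefficient.\<close>

lemma primorial_le: "(\<Prod>p | prime p \<and> p \<le> n. p) \<le> (4::nat) ^ n"
proof (induction n rule: less_induct)
  case (less n)
  consider "n \<le> 1" | "n = 2" | "n > 2" "even n" | m where "n = 2 * m + 1" "m > 0"
  proof (cases "even n")
    case True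
    thus ?thesis using that(1-3) by linarith
  next
    case False
    then obtain m where "n = 2 * m + 1" by (auto elim: oddE)
    thus ?thesis using that(1) that(4)[of m] by (cases "m = 0") auto
  qed
  thus ?case
  proof cases
    case 1
    hence *: "{p. prime p \<and> p \<le> n} = {}" by (auto dest: prime_gt_1_nat)
    show ?thesis unfolding * by simp
  next
    case 2
    hence "{p. prime p \<and> p \<le> n} = {2}"
      by (auto dest: prime_ge_2_nat)
    thus ?thesis using 2 by simp
  next
    case 3
    have "{p. prime p \<and> p \<le> n} = {p. prime p \<and> p \<le> n - 1}"
    proof -
      have "\<not> prime n" using 3 prime_odd_nat[of n] by blast
      hence "p \<le> n - 1" if "prime p" "p \<le> n" for p
        using that by (cases "p = n") auto
      thus ?thesis using 3 by auto
    qed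
    hence "(\<Prod>p | prime p \<and> p \<le> n. p) \<le> 4 ^ (n - 1)"
      using less[of "n - 1"] 3 by simp
    also have "\<dots> \<le> 4 ^ n" by (intro power_increasing) auto
    finally show ?thesis .
  next
    case (4 m)
    let ?C = "(2 * m + 1) choose m"
    let ?P = "{p. prime p \<and> m + 1 < p \<and> p \<le> n}"
    have fin: "finite ?P" by (rule finite_subset[of _ "{..n}"]) auto
    have split: "{p. prime p \<and> p \<le> n} = {p. prime p \<and> p \<le> m + 1} \<union> ?P"
      using 4 by auto
    \<comment> \<open>The primes in \<open>{m + 2..2 * m + 1}\<close> divide the numerator of \<open>?C\<close> but not its denominator.\<close>
    have dvd: "\<Prod>?P dvd ?C"
    proof (rule prod_primes_dvd[OF fin])
      fix p assume p: "p \<in> ?P"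
      have "p dvd fact m * fact (2 * m + 1 - m) * ?C"
        using p 4 by (subst binomial_fact_lemma) (auto simp: prime_dvd_fact_iff simp del: fact_Suc)
      moreover have "\<not> p dvd fact m * fact (2 * m + 1 - m)"
        using p by (auto simp: prime_dvd_mult_iff prime_dvd_fact_iff simp del: fact_Suc)
      ultimately show "p dvd ?C" using p by (auto simp: prime_dvd_mult_iff)
    qed auto
    \<comment> \<open>The two middle entries of row \<open>2 * m + 1\<close> of Pascal's triangle
      are equal, and the whole row sums to \<open>2 * 4 ^ m\<close>.\<close>
    have C: "?C \<le> 4 ^ m"
    proof -
      have "2 * ?C = ?C + ((2 * m + 1) choose (m + 1))"
        using binomial_symmetric[of m "2 * m + 1"] by simp
      also have "\<dots> = (\<Sum>k\<in>{m, m+1}. (2 * m + 1) choose k)" by simp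
      also have "\<dots> \<le> (\<Sum>k\<le>2 * m + 1. (2 * m + 1) choose k)"
        by (rule sum_mono2) auto
      also have "\<dots> = 2 * 4 ^ m"
        unfolding choose_row_sum by (simp add: power_mult)
      finally show ?thesis by simp
    qed
    have "(\<Prod>p | prime p \<and> p \<le> n. p) = (\<Prod>p | prime p \<and> p \<le> m + 1. p) * \<Prod>?P"
      unfolding split using fin by (subst prod.union_disjoint) auto
    also have "\<dots> \<le> 4 ^ (m + 1) * 4 ^ m"
      using less[of "m + 1"] 4 by (intro mult_mono order_trans[OF dvd_imp_le[OF dvd] C]) auto
    also have "\<dots> = 4 ^ n"
      using 4 by (simp add: power_add mult_2)
    finally show ?thesis .
  qed
qed

lemma sum_ln_primes_le: "(\<Sum>p | prime p \<and> p \<le> n. ln (real p)) \<le> real n * ln 4"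
proof -
  have pos: "0 < p" if "p \<in> {p. prime p \<and> p \<le> n}" for p :: nat
    using that prime_gt_0_nat by blast
  have "(\<Sum>p | prime p \<and> p \<le> n. ln (real p)) = ln (\<Prod>p | prime p \<and> p \<le> n. real p)"
    using pos by (subst ln_prod) auto
  also have "(\<Prod>p | prime p \<and> p \<le> n. real p) = real (\<Prod>p | prime p \<and> p \<le> n. p)"
    by simp
  also have "ln \<dots> \<le> ln (real (4 ^ n))"
    using primorial_le[of n] pos by (intro ln_mono) (simp_all only: of_nat_le_iff of_nat_0_less_iff prod_pos)
  also have "\<dots> = real n * ln 4" by (simp add: ln_realpow)
  finally show ?thesis .
qed

section \<open>Telescoping bounds for the correction series\<close>

lemma sum_inverse_consecutive:
  "n \<ge> 1 \<Longrightarrow> (\<Sum>k=2..n. 1 / (real k * (real k - 1))) = 1 - 1 / real n"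
proof (induction n rule: nat_induct_at_least)
  case (Suc n)
  have "1 / (real (Suc n) * (real (Suc n) - 1)) = 1 / real n - 1 / real (Suc n)"
    using Suc by (simp add: field_simps)
  with Suc show ?case by simp
qed simp

text \<open>The right-hand side is chosen to telescope: with \<open>g n = (ln n + 2) / n\<close>, the summand is at
  most \<open>g (k - 1) - g k\<close>, because \<open>k * ln (k / (k - 1)) \<le> k / (k - 1) \<le> 2\<close>.\<close>

lemma sum_ln_consecutive_le:
  "n \<ge> 1 \<Longrightarrow> (\<Sum>k=2..n. ln (real k) / (real k * (real k - 1))) \<le> 2 - (ln (real n) + 2) / real n"
proof (induction n rule: nat_induct_at_least)
  case (Suc n)
  define x where "x = real n"
  have x: "x \<ge> 1" using Suc by (simp add: x_def)
  have "ln ((x + 1) / x) \<le> (x + 1) / x - 1"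
    using x by (intro ln_le_minus_one) auto
  hence "(x + 1) * (ln (x + 1) - ln x) \<le> (x + 1) * (1 / x)"
    using x by (intro mult_left_mono) (auto simp: ln_div field_simps)
  also have "\<dots> \<le> 2" using x by (simp add: field_simps)
  finally have "(x + 1) * ln (x + 1) - (x + 1) * ln x \<le> 2" by (simp add: algebra_simps)
  hence "ln (x + 1) / ((x + 1) * x) \<le> (ln x + 2) / x - (ln (x + 1) + 2) / (x + 1)"
    using x by (simp add: divide_simps) (simp add: algebra_simps)
  thus ?case using Suc by (simp add: x_def add.commute)
qed simp

lemma sum_primes_le_sum:
  fixes f :: "nat \<Rightarrow> real"
  assumes "\<And>k. k \<ge> 2 \<Longrightarrow> f k \<ge> 0"
  shows "(\<Sum>p | prime p \<and> p \<le> n. f p) \<le> (\<Sum>k=2..n. f k)"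
  using assms by (intro sum_mono2) (auto dest: prime_ge_2_nat)

section \<open>Mertens' first theorem\<close>

text \<open>Inserting the lower bound n/p - 1 for the exponents into \<open>ln (fact n)\<close>
  leaves an error equal to the sum of \<open>ln p\<close>, which Chebyshev's bound limits to
  \<open>n * ln 4\<close>.\<close>

lemma Mertens1_upper:
  assumes "n > 0"
  shows "(\<Sum>p | prime p \<and> p \<le> n. ln (real p) / real p) \<le> ln (real n) + ln 4"
proof -
  have "real n * (\<Sum>p | prime p \<and> p \<le> n. ln (real p) / real p) -
        (\<Sum>p | prime p \<and> p \<le> n. ln (real p)) =
        (\<Sum>p | prime p \<and> p \<le> n. ln (real p) * (real n / real p - 1))"
    by (simp add: sum_distrib_left algebra_simps flip: sum_subtractf)
  also have "\<dots> \<le> ln (fact n)"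
    unfolding ln_fact_prime_sum
    by (intro sum_mono mult_left_mono sum_multiplicity_lower) (auto dest: prime_ge_1_nat)
  also have "\<dots> \<le> real n * ln (real n)" by (rule ln_fact_upper)
  finally have "real n * (\<Sum>p | prime p \<and> p \<le> n. ln (real p) / real p) \<le>
      real n * (ln (real n) + ln 4)"
    using sum_ln_primes_le[of n] by (simp add: algebra_simps)
  thus ?thesis using assms by simp
qed

text \<open>The constant 3 is 1 from the Stirling bound plus 2 from the correction series
  \<open>?c\<close>.\<close>

lemma Mertens1_lower:
  assumes "n > 0"
  shows "ln (real n) - 3 \<le> (\<Sum>p | prime p \<and> p \<le> n. ln (real p) / real p)"
proof -
  let ?A = "\<Sum>p | prime p \<and> p \<le> n. ln (real p) / real p"
  let ?c = "\<Sum>p | prime p \<and> p \<le> n. ln (real p) / (real p * (real p - 1))"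
  have "?c \<le> (\<Sum>k=2..n. ln (real k) / (real k * (real k - 1)))"
    by (rule sum_primes_le_sum) auto
  also have "\<dots> \<le> 2 - (ln (real n) + 2) / real n"
    using assms by (intro sum_ln_consecutive_le) auto
  also have "\<dots> \<le> 2" using assms by simp
  finally have c: "?c \<le> 2" .
  have "real n * ln (real n) - real n \<le> ln (fact n)"
    using assms by (rule ln_fact_lower)
  also have "\<dots> \<le> (\<Sum>p | prime p \<and> p \<le> n.
      ln (real p) * (real n * (1 / real p + 1 / (real p * (real p - 1)))))"
    unfolding ln_fact_prime_sum
    by (intro sum_mono mult_left_mono sum_multiplicity_upper) (auto dest: prime_ge_1_nat)
  also have "\<dots> = real n * (?A + ?c)"
    unfolding sum.distrib[symmetric] sum_distrib_left
    by (intro sum.cong) (auto simp: algebra_simps)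
  finally have "real n * (ln (real n) - 1) \<le> real n * (?A + ?c)"
    by (simp add: algebra_simps)
  hence "ln (real n) - 1 \<le> ?A + ?c"
    using assms by simp
  with c show ?thesis by simp
qed

section \<open>Abel summation and Mertens' second theorem\<close>

lemma sum_div_ln_Abel:
  fixes a :: "nat \<Rightarrow> real"
  defines "A \<equiv> \<lambda>n. \<Sum>k=2..n. a k"
  assumes "n \<ge> 2"
  shows "(\<Sum>k=2..n. a k / ln (real k)) =
           A n / ln (real n) + (\<Sum>k=2..<n. A k * (1 / ln (real k) - 1 / ln (real (Suc k))))"
  using assms(2)
proof (induction n rule: nat_induct_at_least)
  case (Suc n)
  thus ?case by (simp add: A_def add_divide_distrib algebra_simps)
qed (simp add: A_def)

lemma sum_inverse_ln_telescope:
  "n \<ge> 2 \<Longrightarrow> (\<Sum>k=2..<n. 1 / ln (real k) - 1 / ln (real (Suc k))) = 1 / ln 2 - 1 / ln (real n)"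
  by (induction n rule: nat_induct_at_least) auto

text \<open>Both parts come from \<open>ln y \<le> y - 1\<close>, at \<open>y = u / v\<close> and
  \<open>y = v / u\<close>. The two resulting bounds differ by
  \<open>(v - u) * (1 / u - 1 / v)\<close>, and \<open>v - u \<le> 1\<close> makes this at most a
  telescoping difference.\<close>

lemma ln_ln_step:
  fixes x :: real
  assumes "x > 1"
  shows "1 - ln x / ln (x + 1) \<le> ln (ln (x + 1)) - ln (ln x)"
    and "ln (ln (x + 1)) - ln (ln x) - (1 / ln x - 1 / ln (x + 1)) \<le> 1 - ln x / ln (x + 1)"
proof -
  define u v where "u = ln x" and "v = ln (x + 1)"
  have u: "u > 0" and uv: "u < v" using assms by (auto simp: u_def v_def)
  have "ln (u / v) \<le> u / v - 1" using u uv by (intro ln_le_minus_one) auto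
  thus "1 - ln x / ln (x + 1) \<le> ln (ln (x + 1)) - ln (ln x)"
    using u uv by (simp add: ln_div flip: u_def v_def)
  have "ln (v / u) \<le> v / u - 1" using u uv by (intro ln_le_minus_one) auto
  hence 1: "ln v - ln u \<le> v / u - 1" using u uv by (simp add: ln_div)
  have "ln ((x + 1) / x) \<le> (x + 1) / x - 1" using assms by (intro ln_le_minus_one) auto
  also have "\<dots> \<le> 1" using assms by (simp add: field_simps)
  finally have "v - u \<le> 1" using assms by (simp add: ln_div u_def v_def)
  hence "(v - u) * (1 / u - 1 / v) \<le> 1 * (1 / u - 1 / v)"
    using u uv by (intro mult_right_mono) (auto simp: field_simps)
  moreover have "(v - u) * (1 / u - 1 / v) = (v / u - 1) - (1 - u / v)"
    using u uv by (simp add: field_simps)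
  ultimately show "ln (ln (x + 1)) - ln (ln x) - (1 / ln x - 1 / ln (x + 1)) \<le> 1 - ln x / ln (x + 1)"
    using 1 by (simp flip: u_def v_def)
qed

text \<open>Crude values for the boundary terms at \<open>k = 2\<close>, all from
  \<open>ln y \<le> y - 1\<close> with \<open>y\<close> equal to 1/2, \<open>1 / ln 2\<close> and
  2.\<close>

lemma ln2_bounds: "ln 2 > (0::real)" "1 / ln 2 \<le> (2::real)" "- 1 \<le> ln (ln (2::real))" "ln (ln (2::real)) \<le> 0"
proof -
  show pos: "ln 2 > (0::real)" by simp
  have "ln (1 / 2) \<le> 1 / 2 - (1::real)" by (intro ln_le_minus_one) auto
  thus *: "1 / ln 2 \<le> (2::real)" using pos by (simp add: ln_div field_simps)
  have "ln (1 / ln 2) \<le> 1 / ln 2 - (1::real)" using pos by (intro ln_le_minus_one) auto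
  thus "- 1 \<le> ln (ln (2::real))" using pos * by (simp add: ln_div)
  have "ln 2 \<le> 2 - (1::real)" by (intro ln_le_minus_one) auto
  thus "ln (ln (2::real)) \<le> 0" using pos by simp
qed

text \<open>\<open>M\<close> is a discrete form of the integral of 1/(x log x): its terms are
  compared with the increments of \<open>ln (ln k)\<close>. The upper bound loses
  \<open>- ln (ln 2) \<le> 1\<close>, the lower one \<open>1 / ln 2 \<le> 2\<close>.\<close>

lemma sum_ln_ratio_bounds:
  fixes n :: nat
  assumes "n \<ge> 2"
  defines "M \<equiv> \<Sum>k=2..<n. ln (real k) * (1 / ln (real k) - 1 / ln (real (Suc k)))"
  shows "M \<le> ln (ln (real n)) + 1" "ln (ln (real n)) - 2 \<le> M"
proof -
  have tele: "(\<Sum>k=2..<n. ln (ln (real (Suc k))) - ln (ln (real k))) = ln (ln (real n)) - ln (ln 2)"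
    using sum_Suc_diff'[of 2 n "\<lambda>k. ln (ln (real k))"] assms by simp
  have M: "M = (\<Sum>k=2..<n. 1 - ln (real k) / ln (real (Suc k)))"
    unfolding M_def by (intro sum.cong) (auto simp: field_simps)
  have "M \<le> (\<Sum>k=2..<n. ln (ln (real (Suc k))) - ln (ln (real k)))"
    unfolding M using ln_ln_step(1)[of "real k" for k]
    by (intro sum_mono) (simp add: add.commute)
  with tele ln2_bounds show "M \<le> ln (ln (real n)) + 1" by simp
  have "(\<Sum>k=2..<n. (ln (ln (real (Suc k))) - ln (ln (real k))) -
           (1 / ln (real k) - 1 / ln (real (Suc k)))) \<le> M"
    unfolding M using ln_ln_step(2)[of "real k" for k]
    by (intro sum_mono) (simp add: add.commute)
  hence "ln (ln (real n)) - ln (ln 2) - (1 / ln 2 - 1 / ln (real n)) \<le> M"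
    using tele sum_inverse_ln_telescope[OF assms(1)] by (simp add: sum_subtractf)
  moreover have "1 / ln (real n) \<ge> 0" using assms by simp
  ultimately show "ln (ln (real n)) - 2 \<le> M" using ln2_bounds by linarith
qed

text \<open>Partial sums \<open>A k\<close> are replaced by \<open>ln k + c\<close>, with
  \<open>c = ln 4\<close> above and \<open>c = - 3\<close> below. The result
  \<open>1 + M + c / ln 2\<close> is at most 1 + 1 + 2 = 4 above \<open>ln (ln n)\<close> and at
  most - 1 + 2 + 6 = 7 below it.\<close>

lemma Mertens2:
  fixes n :: nat
  assumes "n \<ge> 2"
  defines "B \<equiv> \<Sum>p | prime p \<and> p \<le> n. 1 / real p"
  shows "B \<le> ln (ln (real n)) + 4" "ln (ln (real n)) - 7 \<le> B"
proof -
  \<comment> \<open>Extension by 0 off the primes puts the sums into the interval form that Abel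
    summation needs.\<close>
  define a where "a = (\<lambda>k. if prime k then ln (real k) / real k else 0)"
  define A where "A = (\<lambda>n. \<Sum>k=2..n. a k)"
  define d where "d = (\<lambda>k. 1 / ln (real k) - 1 / ln (real (Suc k)))"
  define M where "M = (\<Sum>k=2..<n. ln (real k) * d k)"
  have primes: "(\<Sum>k=2..m. if prime k then f k else 0) = (\<Sum>p | prime p \<and> p \<le> m. f p)"
    for m and f :: "nat \<Rightarrow> real"
  proof -
    have "{p. prime p \<and> p \<le> m} = {k\<in>{2..m}. prime k}" by (auto dest: prime_ge_2_nat)
    thus ?thesis by (simp only: sum.inter_filter finite_atLeastAtMost)
  qed
  have A: "A m = (\<Sum>p | prime p \<and> p \<le> m. ln (real p) / real p)" for m
    unfolding A_def a_def by (rule primes)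
  have "B = (\<Sum>k=2..n. a k / ln (real k))"
    unfolding B_def primes[symmetric] by (intro sum.cong) (auto simp: a_def)
  also have "\<dots> = A n / ln (real n) + (\<Sum>k=2..<n. A k * d k)"
    unfolding A_def d_def by (rule sum_div_ln_Abel[OF assms(1)])
  finally have B: "B = A n / ln (real n) + (\<Sum>k=2..<n. A k * d k)" .
  have d: "d k \<ge> 0" if "k \<ge> 2" for k
    using that by (auto simp: d_def intro!: divide_left_mono mult_pos_pos)
  have dsum: "(\<Sum>k=2..<n. d k) = 1 / ln 2 - 1 / ln (real n)"
    unfolding d_def by (rule sum_inverse_ln_telescope[OF assms(1)])
  have n: "ln (real n) > 0" using assms by simp
  \<comment> \<open>The boundary term \<open>c / ln n\<close> cancels against the end of the
    telescoped sum of \<open>d\<close>, so only \<open>c / ln 2\<close> remains.\<close>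
  have main: "(ln (real n) + c) / ln (real n) + (\<Sum>k=2..<n. (ln (real k) + c) * d k) =
      1 + M + c / ln 2" for c
  proof -
    have "(\<Sum>k=2..<n. (ln (real k) + c) * d k) = M + c * (\<Sum>k=2..<n. d k)"
      by (simp add: M_def algebra_simps sum.distrib sum_distrib_left)
    thus ?thesis using n unfolding dsum by (simp add: field_simps)
  qed
  have M: "M \<le> ln (ln (real n)) + 1" "ln (ln (real n)) - 2 \<le> M"
    unfolding M_def d_def using sum_ln_ratio_bounds[OF assms(1)] by blast+
  have "B \<le> (ln (real n) + ln 4) / ln (real n) + (\<Sum>k=2..<n. (ln (real k) + ln 4) * d k)"
    unfolding B A using n assms d
    by (intro add_mono divide_right_mono sum_mono mult_right_mono Mertens1_upper) auto
  also have "\<dots> = 1 + M + ln 4 / ln 2" by (rule main)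
  also have "ln 4 / ln 2 = (2::real)"
    using ln_realpow[of 2 2] by simp
  finally show "B \<le> ln (ln (real n)) + 4" using M by simp
  have "1 + M + (- 3) / ln 2 =
      (ln (real n) + (- 3)) / ln (real n) + (\<Sum>k=2..<n. (ln (real k) + (- 3)) * d k)"
    by (rule main[symmetric])
  also have "\<dots> \<le> B"
    unfolding B A using n assms d Mertens1_lower
    by (intro add_mono divide_right_mono sum_mono mult_right_mono) auto
  finally show "ln (ln (real n)) - 7 \<le> B" using M ln2_bounds by simp
qed

section \<open>The summatory function of \<open>prime_Omega\<close>\<close>

text \<open>The constant 8 is dictated by the lower bound: 7 from \<open>Mertens2\<close>, and 1
  because each of the at most \<open>n\<close> primes loses 1 in the exponent bound. The upper bound
  would need only 4 + 1.\<close>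

lemma sum_prime_Omega_bounds:
  fixes n :: nat
  assumes "n \<ge> 2"
  shows "\<bar>(\<Sum>k=1..n. real (prime_Omega k)) - real n * ln (ln (real n))\<bar> \<le> 8 * real n"
proof -
  let ?S = "\<Sum>k=1..n. real (prime_Omega k)"
  let ?B = "\<Sum>p | prime p \<and> p \<le> n. 1 / real p"
  let ?c = "\<Sum>p | prime p \<and> p \<le> n. 1 / (real p * (real p - 1))"
  have "?c \<le> (\<Sum>k=2..n. 1 / (real k * (real k - 1)))"
    by (rule sum_primes_le_sum) auto
  also have "\<dots> = 1 - 1 / real n" using assms by (intro sum_inverse_consecutive) auto
  finally have c: "?c \<le> 1" using assms by (smt (verit) divide_nonneg_nonneg of_nat_0_le_iff)
  have "?S \<le> (\<Sum>p | prime p \<and> p \<le> n. real n * (1 / real p + 1 / (real p * (real p - 1))))"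
    unfolding sum_prime_Omega by (intro sum_mono sum_multiplicity_upper) auto
  also have "\<dots> = real n * (?B + ?c)"
    by (simp only: sum.distrib flip: sum_distrib_left)
  also have "\<dots> \<le> real n * (ln (ln (real n)) + 8)"
    using c Mertens2[OF assms] by (intro mult_left_mono) auto
  finally have upper: "?S \<le> real n * (ln (ln (real n)) + 8)" .
  have "card {p. prime p \<and> p \<le> n} \<le> card {1..n}"
    by (intro card_mono) (auto dest: prime_ge_1_nat)
  hence "real n * (ln (ln (real n)) - 8) \<le> real n * (?B - 1) + real n - card {p. prime p \<and> p \<le> n}"
    using Mertens2[OF assms] mult_left_mono[of "ln (ln (real n)) - 7" ?B "real n"]
    by (simp add: algebra_simps)
  also have "\<dots> = (\<Sum>p | prime p \<and> p \<le> n. real n / real p - 1)"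
    by (simp add: sum_subtractf sum_distrib_left algebra_simps)
  also have "\<dots> \<le> ?S"
    unfolding sum_prime_Omega by (intro sum_mono sum_multiplicity_lower) auto
  finally show ?thesis using upper by (simp add: algebra_simps abs_le_iff)
qed

lemma two_power_prime_Omega_le: "n > 0 \<Longrightarrow> 2 ^ prime_Omega n \<le> n"
proof -
  assume n: "n > 0"
  have "(2::nat) ^ size M \<le> prod_mset M" if "\<And>p. p \<in># M \<Longrightarrow> p \<ge> 2" for M :: "nat multiset"
    using that by (induction M) (auto intro!: mult_mono)
  from this[of "prime_factorization n"] show ?thesis
    using n by (auto simp: prime_Omega_def
        dest: in_prime_factors_imp_prime prime_ge_2_nat)
qed

theorem mainTheorem1:
  fixes n :: nat
  assumes "n \<ge> 3"
  shows "\<bar>(\<Sum>k=1..n. real (prime_Omega k)) - (real n - 1) * ln (ln (real n - 1))\<bar>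
           < 23 * (real n - 1)"
proof -
  obtain m where n: "n = Suc m" and m: "m \<ge> 2" using assms by (cases n) auto
  \<comment> \<open>Strictness matters: it yields \<open>prime_Omega n \<le> n - 1 = m\<close>, so
    the total error is at most \<open>9 * m\<close>, below \<open>23 * m\<close> as \<open>m\<close>
    is positive.\<close>
  have "prime_Omega n < 2 ^ prime_Omega n" by simp
  also have "\<dots> \<le> n" using n by (intro two_power_prime_Omega_le) simp
  finally have "real (prime_Omega n) \<le> real m" using n by simp
  moreover have "(\<Sum>k=1..n. real (prime_Omega k)) =
      (\<Sum>k=1..m. real (prime_Omega k)) + real (prime_Omega n)"
    using n by simp
  moreover have "real n - 1 = real m" using n by simp
  ultimately show ?thesis using sum_prime_Omega_bounds[OF m] m
    by simp
qed

end
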